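(* Let $m\ge3$ be an odd integer and $n$ an integer with $2m<n$, and let $\lambda\ge\frac{n}{n-2m}$ be a constant. Let $\varphi:(0,1)\to(0,\infty)$ be continuous with $\lim_{r\to0^+}\varphi(r)=\infty$. Then there exists a $C^\infty$ positive solution $u$ of $$0\le-\Delta^m u\le u^\lambda\quad\text{in }\mathbb{R}^n\setminus\{0\}$$ such that $u(x)\neq O(\varphi(|x|))$ as $x\to 0$.
   Context: $\Delta^m$ is the $m$-fold iterated Laplacian. For positive functions, "$u(x)\neq O(h(x))$ as $x\to0$" means $\limsup_{x\to0} u(x)/h(x)=\infty$. *)

theory Defs
  imports "HOL-Analysis.Analysis" "HOL-Library.Liminf_Limsup"
begin

definition partial :: "'n::finite \<Rightarrow> (real^'n \<Rightarrow> real) \<Rightarrow> real^'n \<Rightarrow> real" where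
  "partial i f x = deriv (\<lambda>t. f (x + t *\<^sub>R axis i 1)) 0"

definition iter_partial :: "'n::finite list \<Rightarrow> (real^'n \<Rightarrow> real) \<Rightarrow> real^'n \<Rightarrow> real" where
  "iter_partial is f = foldr partial is f"

definition smooth_on :: "(real^'n::finite) set \<Rightarrow> (real^'n \<Rightarrow> real) \<Rightarrow> bool" where
  "smooth_on S f \<longleftrightarrow>
     (\<forall>is. continuous_on S (iter_partial is f) \<and>
        (\<forall>i. \<forall>x\<in>S. (\<lambda>t. iter_partial is f (x + t *\<^sub>R axis i 1)) differentiable (at 0)))"

definition laplacian :: "(real^'n::finite \<Rightarrow> real) \<Rightarrow> real^'n \<Rightarrow> real" where
  "laplacian f x = (\<Sum>i\<in>UNIV. partial i (partial i f) x)"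

end

(* With N = n/2 and h = N - m > 0, the function (s + |y|^2)^(-h) satisfies
     Delta^m (s + |y|^2)^(-h) = (h)_(2m) (-4s)^m (s + |y|^2)^(-N-m),
   which is negative for odd m and s > 0 and vanishes for s = 0. Put such bubbles, all with the same
   large mass eps, at points a_j = 2^(-j-1) e. The sum diverges, but it converges after subtracting
   eps |x|^(2m-n) from each term, which does not change Delta^m away from 0. The j-th difference is
   bounded below by -const 2^(-j) |x|^(2m-n-1), and 2m - n - 1 >= 2 - n, so adding a large multiple of
   1 + |x|^(2-n), which is harmonic, makes the sum larger than 1 + (the j-th bubble), for every j.
   If the concentrations s_j tend to 0 fast enough, then at every x at most one source is not
   summably small, and that one is dominated by the power lam of its own bubble; moreover the height
   eps s_j^(-h) of the bubble at a_j exceeds j phi(|a_j|). *)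
theory Submission
  imports Defs "HOL-Real_Asymp.Real_Asymp"
begin

text \<open>For \<open>s > 0\<close> this is the whole space, for \<open>s = 0\<close> the
  complement of the origin. Smooth bubbles and the singular power subtracted from them are thereby
  treated as one family.\<close>

definition sreg :: "real \<Rightarrow> (real^'n::finite) set" where
  "sreg s = {y. 0 < s + y \<bullet> y}"

lemma open_sreg: "open (sreg s)"
  unfolding sreg_def by (intro open_Collect_less continuous_intros)

section \<open>Kernels and their iterated Laplacians\<close>

text \<open>Functions of a point \<^term>\<open>y\<close> and a smoothing parameter \<^term>\<open>s \<ge> 0\<close>, relevant only where
  \<^term>\<open>y \<in> sreg s\<close>. The class is just large enough to contain the powers of \<^term>\<open>s + y \<bullet> y\<close> and to be
  closed under partial derivatives in \<^term>\<open>y\<close>; its Lipschitz bounds in both arguments jointly give the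
  convergence of the series, together with all derivatives, at once.\<close>

inductive kernel :: "(real^'n::finite \<Rightarrow> real \<Rightarrow> real) \<Rightarrow> bool" where
  const: "kernel (\<lambda>y s. c)"
| coord: "kernel (\<lambda>y s. y $ i)"
| pow: "kernel (\<lambda>y s. (s + y \<bullet> y) powr q)"
| add: "kernel K \<Longrightarrow> kernel L \<Longrightarrow> kernel (\<lambda>y s. K y s + L y s)"
| mult: "kernel K \<Longrightarrow> kernel L \<Longrightarrow> kernel (\<lambda>y s. K y s * L y s)"
| cong: "kernel K \<Longrightarrow> (\<And>y s. 0 \<le> s \<Longrightarrow> y \<in> sreg s \<Longrightarrow> L y s = K y s) \<Longrightarrow> kernel L"

lemma kernel_sum: "finite I \<Longrightarrow> (\<And>i. i \<in> I \<Longrightarrow> kernel (K i)) \<Longrightarrow> kernel (\<lambda>y s. \<Sum>i\<in>I. K i y s)"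
proof (induction rule: finite_induct)
  case empty
  show ?case by (simp add: kernel.const)
next
  case (insert i I)
  then show ?case by (simp add: kernel.add)
qed

section \<open>Partial derivatives of kernels\<close>

lemma eventually_line_in_open:
  fixes y :: "real^'n::finite"
  assumes "open S" "y \<in> S"
  shows "eventually (\<lambda>t. y + t *\<^sub>R v \<in> S) (nhds 0)"
proof -
  have "((\<lambda>t::real. y + t *\<^sub>R v) \<longlongrightarrow> y + 0 *\<^sub>R v) (nhds 0)"
    by (intro tendsto_intros filterlim_ident)
  then show ?thesis
    using assms by (auto dest!: topological_tendstoD)
qed

lemma has_deriv_pow:
  fixes y :: "real^'n::finite"
  assumes "y \<in> sreg s"
  shows "((\<lambda>t. (s + (y + t *\<^sub>R axis i 1) \<bullet> (y + t *\<^sub>R axis i 1)) powr q)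
           has_real_derivative 2 * q * y $ i * (s + y \<bullet> y) powr (q - 1)) (at 0)"
proof -
  have eq: "s + (y + t *\<^sub>R axis i 1) \<bullet> (y + t *\<^sub>R axis i 1) = s + y \<bullet> y + 2 * t * y $ i + t\<^sup>2" for t
    by (simp add: inner_add_left inner_add_right inner_axis inner_axis' power2_eq_square algebra_simps)
  show ?thesis
    unfolding eq using assms by (auto intro!: derivative_eq_intros simp: sreg_def)
qed

text \<open>Induction over the class with the sum and product rules. In the case \<open>cong\<close>
  the two functions agree near the point because \<open>sreg s\<close> is open.\<close>

lemma kernel_has_deriv:
  fixes K :: "real^'n::finite \<Rightarrow> real \<Rightarrow> real"
  assumes "kernel K"
  shows "\<exists>L. kernel L \<and> (\<forall>s\<ge>0. \<forall>y\<in>sreg s.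
           ((\<lambda>t. K (y + t *\<^sub>R axis i 1) s) has_real_derivative L y s) (at 0))"
  using assms
proof induction
  case (const c)
  show ?case by (intro exI[of _ "\<lambda>y s. 0"]) (auto intro!: kernel.const)
next
  case (coord k)
  have "((\<lambda>t. (y + t *\<^sub>R axis i 1) $ k) has_real_derivative axis i 1 $ k) (at 0)" for y :: "real^'n"
    by (auto intro!: derivative_eq_intros)
  then show ?case by (intro exI[of _ "\<lambda>y s. axis i 1 $ k"]) (auto intro!: kernel.const)
next
  case (pow q)
  show ?case
    by (intro exI[of _ "\<lambda>y s. 2 * q * y $ i * (s + y \<bullet> y) powr (q - 1)"])
      (auto intro: has_deriv_pow intro!: kernel.mult kernel.const kernel.coord kernel.pow)
next
  case (add K L)
  then obtain K' L' where "kernel K'" "kernel L'"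
    and "\<forall>s\<ge>0. \<forall>y\<in>sreg s. ((\<lambda>t. K (y + t *\<^sub>R axis i 1) s) has_real_derivative K' y s) (at 0)"
    and "\<forall>s\<ge>0. \<forall>y\<in>sreg s. ((\<lambda>t. L (y + t *\<^sub>R axis i 1) s) has_real_derivative L' y s) (at 0)"
    by blast
  then show ?case
    by (intro exI[of _ "\<lambda>y s. K' y s + L' y s"]) (auto intro!: kernel.add DERIV_add)
next
  case (mult K L)
  then obtain K' L' where k: "kernel K'" "kernel L'"
    and d: "\<forall>s\<ge>0. \<forall>y\<in>sreg s. ((\<lambda>t. K (y + t *\<^sub>R axis i 1) s) has_real_derivative K' y s) (at 0)"
     "\<forall>s\<ge>0. \<forall>y\<in>sreg s. ((\<lambda>t. L (y + t *\<^sub>R axis i 1) s) has_real_derivative L' y s) (at 0)"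
    by blast
  have "((\<lambda>t. K (y + t *\<^sub>R axis i 1) s * L (y + t *\<^sub>R axis i 1) s)
          has_real_derivative K' y s * L y s + L' y s * K y s) (at 0)" if "s \<ge> 0" "y \<in> sreg s" for y s
    using DERIV_mult[OF d(1)[rule_format, OF that] d(2)[rule_format, OF that]] by simp
  then show ?case
    using k mult.hyps by (intro exI[of _ "\<lambda>y s. K' y s * L y s + L' y s * K y s"]) (auto intro: kernel.add kernel.mult)
next
  case (cong K L)
  then obtain K' where k: "kernel K'"
    and d: "\<And>s y. s \<ge> 0 \<Longrightarrow> y \<in> sreg s \<Longrightarrow> ((\<lambda>t. K (y + t *\<^sub>R axis i 1) s) has_real_derivative K' y s) (at 0)"
    by blast
  have "((\<lambda>t. L (y + t *\<^sub>R axis i 1) s) has_real_derivative K' y s) (at 0)"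
    if "s \<ge> 0" "y \<in> sreg s" for y s
  proof -
    have "eventually (\<lambda>t. L (y + t *\<^sub>R axis i 1) s = K (y + t *\<^sub>R axis i 1) s) (nhds 0)"
      using eventually_line_in_open[OF open_sreg that(2)]
      by eventually_elim (use cong.hyps that in auto)
    then show ?thesis
      using d[OF that] by (subst DERIV_cong_ev[OF refl _ refl])
  qed
  then show ?case using k by blast
qed

definition kpartial :: "'n::finite \<Rightarrow> (real^'n \<Rightarrow> real \<Rightarrow> real) \<Rightarrow> real^'n \<Rightarrow> real \<Rightarrow> real" where
  "kpartial i K y s = partial i (\<lambda>z. K z s) y"

definition klaplacian :: "(real^'n::finite \<Rightarrow> real \<Rightarrow> real) \<Rightarrow> real^'n \<Rightarrow> real \<Rightarrow> real" where
  "klaplacian K y s = laplacian (\<lambda>z. K z s) y"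

text \<open>\<open>kpartial\<close> is built from \<open>deriv\<close> and is known to agree with
  the symbolic derivative only on \<open>sreg s\<close>. The rule \<open>cong\<close> of
  \<open>kernel\<close> absorbs this difference.\<close>

lemma kernel_kpartial:
  assumes "kernel K"
  shows "kernel (kpartial i K)"
    and "0 \<le> s \<Longrightarrow> y \<in> sreg s \<Longrightarrow>
           ((\<lambda>t. K (y + t *\<^sub>R axis i 1) s) has_real_derivative kpartial i K y s) (at 0)"
proof -
  obtain L where L: "kernel L"
    and d: "\<And>s y. s \<ge> 0 \<Longrightarrow> y \<in> sreg s \<Longrightarrow> ((\<lambda>t. K (y + t *\<^sub>R axis i 1) s) has_real_derivative L y s) (at 0)"
    using kernel_has_deriv[OF assms] by blast
  have eq: "kpartial i K y s = L y s" if "s \<ge> 0" "y \<in> sreg s" for y s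
    using DERIV_imp_deriv[OF d[OF that]] by (simp add: kpartial_def partial_def)
  show "kernel (kpartial i K)" by (rule kernel.cong[OF L]) (rule eq)
  show "((\<lambda>t. K (y + t *\<^sub>R axis i 1) s) has_real_derivative kpartial i K y s) (at 0)"
    if "0 \<le> s" "y \<in> sreg s" using d[OF that] eq[OF that] by simp
qed

lemma klaplacian_eq: "klaplacian K y s = (\<Sum>i\<in>UNIV. kpartial i (kpartial i K) y s)"
  by (simp add: klaplacian_def laplacian_def kpartial_def)

lemma kernel_klaplacian: "kernel K \<Longrightarrow> kernel (klaplacian K)"
  by (rule kernel.cong[OF kernel_sum[of UNIV "\<lambda>i. kpartial i (kpartial i K)"]])
    (auto simp: kernel_kpartial klaplacian_eq)

lemma kernel_klaplacian_funpow: "kernel K \<Longrightarrow> kernel ((klaplacian ^^ j) K)"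
  by (induction j) (auto intro: kernel_klaplacian)

lemma klaplacian_funpow: "(klaplacian ^^ j) K y s = (laplacian ^^ j) (\<lambda>z. K z s) y"
proof (induction j arbitrary: y)
  case (Suc j)
  have "(\<lambda>z. (klaplacian ^^ j) K z s) = (laplacian ^^ j) (\<lambda>z. K z s)"
    using Suc by auto
  then show ?case by (simp add: klaplacian_def[of "(klaplacian ^^ j) K"])
qed simp

section \<open>Locality and linearity of the iterated Laplacian\<close>

lemma partial_cong_open:
  fixes f g :: "real^'n::finite \<Rightarrow> real"
  assumes "open S" "x \<in> S" "\<And>y. y \<in> S \<Longrightarrow> f y = g y"
  shows "partial i f x = partial i g x"
  unfolding partial_def
  using eventually_line_in_open[OF assms(1,2), of "axis i 1"] assms(3)
  by (intro deriv_cong_ev refl) (auto elim!: eventually_mono)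

lemma laplacian_cong_open:
  fixes f g :: "real^'n::finite \<Rightarrow> real"
  assumes "open S" "x \<in> S" "\<And>y. y \<in> S \<Longrightarrow> f y = g y"
  shows "laplacian f x = laplacian g x"
  unfolding laplacian_def
  by (intro sum.cong refl partial_cong_open[OF assms(1,2)] partial_cong_open[OF assms(1)] assms(3))

text \<open>Differentiation is local. Identities between kernels hold only off the singularity, so a
  function can be replaced under the Laplacian only on an open set.\<close>

lemma laplacian_funpow_cong_open:
  fixes f g :: "real^'n::finite \<Rightarrow> real"
  assumes "open S" "x \<in> S" "\<And>y. y \<in> S \<Longrightarrow> f y = g y"
  shows "(laplacian ^^ j) f x = (laplacian ^^ j) g x"
  using assms(2)
proof (induction j arbitrary: x)
  case (Suc j)
  then show ?case by (auto intro!: laplacian_cong_open[OF assms(1)])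
qed (use assms in auto)

lemma kpartial_lincomb:
  assumes "kernel K" "kernel L" "0 \<le> s" "y \<in> sreg s"
  shows "kpartial i (\<lambda>y s. \<alpha> * K y s + \<beta> * L y s) y s = \<alpha> * kpartial i K y s + \<beta> * kpartial i L y s"
proof -
  have "((\<lambda>t. \<alpha> * K (y + t *\<^sub>R axis i 1) s + \<beta> * L (y + t *\<^sub>R axis i 1) s)
     has_real_derivative \<alpha> * kpartial i K y s + \<beta> * kpartial i L y s) (at 0)"
    using assms by (intro DERIV_add DERIV_cmult kernel_kpartial)
  from DERIV_imp_deriv[OF this] show ?thesis by (simp add: kpartial_def partial_def)
qed

lemma klaplacian_lincomb:
  fixes K L :: "real^'n::finite \<Rightarrow> real \<Rightarrow> real"
  assumes "kernel K" "kernel L" "0 \<le> s" "y \<in> sreg s"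
  shows "klaplacian (\<lambda>y s. \<alpha> * K y s + \<beta> * L y s) y s = \<alpha> * klaplacian K y s + \<beta> * klaplacian L y s"
proof -
  have "kpartial i (kpartial i (\<lambda>y s. \<alpha> * K y s + \<beta> * L y s)) y s
      = \<alpha> * kpartial i (kpartial i K) y s + \<beta> * kpartial i (kpartial i L) y s" for i
  proof -
    have "kpartial i (kpartial i (\<lambda>y s. \<alpha> * K y s + \<beta> * L y s)) y s
        = kpartial i (\<lambda>y s. \<alpha> * kpartial i K y s + \<beta> * kpartial i L y s) y s"
      unfolding kpartial_def[of i "kpartial i (\<lambda>y s. \<alpha> * K y s + \<beta> * L y s)"]
        kpartial_def[of i "\<lambda>y s. \<alpha> * kpartial i K y s + \<beta> * kpartial i L y s"]
      using assms by (intro partial_cong_open[OF open_sreg] kpartial_lincomb)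
    then show ?thesis
      using assms by (simp add: kpartial_lincomb kernel_kpartial)
  qed
  then show ?thesis
    by (simp add: klaplacian_eq sum.distrib sum_distrib_left)
qed

lemma klaplacian_funpow_lincomb:
  fixes K L :: "real^'n::finite \<Rightarrow> real \<Rightarrow> real"
  assumes "kernel K" "kernel L" "0 \<le> s" "y \<in> sreg s"
  shows "(klaplacian ^^ j) (\<lambda>y s. \<alpha> * K y s + \<beta> * L y s) y s
       = \<alpha> * (klaplacian ^^ j) K y s + \<beta> * (klaplacian ^^ j) L y s"
  using assms(4)
proof (induction j arbitrary: y)
  case (Suc j)
  have "(klaplacian ^^ Suc j) (\<lambda>y s. \<alpha> * K y s + \<beta> * L y s) y s
      = klaplacian (\<lambda>y s. \<alpha> * (klaplacian ^^ j) K y s + \<beta> * (klaplacian ^^ j) L y s) y s"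
    unfolding funpow.simps comp_def klaplacian_def[of "(klaplacian ^^ j) _"]
      klaplacian_def[of "\<lambda>y s. \<alpha> * (klaplacian ^^ j) K y s + \<beta> * (klaplacian ^^ j) L y s"]
    using Suc by (intro laplacian_cong_open[OF open_sreg[of s]]) auto
  also have "\<dots> = \<alpha> * (klaplacian ^^ Suc j) K y s + \<beta> * (klaplacian ^^ Suc j) L y s"
    using assms Suc.prems by (simp add: klaplacian_lincomb kernel_klaplacian_funpow)
  finally show ?case .
qed simp

lemma klaplacian_funpow_cmult:
  fixes K :: "real^'n::finite \<Rightarrow> real \<Rightarrow> real"
  assumes "kernel K" "0 \<le> s" "y \<in> sreg s"
  shows "(klaplacian ^^ j) (\<lambda>y s. \<alpha> * K y s) y s = \<alpha> * (klaplacian ^^ j) K y s"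
  using klaplacian_funpow_lincomb[OF assms(1,1,2,3), of j \<alpha> 0] by simp

section \<open>The iterated Laplacian of a bubble\<close>

text \<open>With R = s + |y|^2, the gradient satisfies |grad R|^2 = 4 (R - s) and Delta R = 2n.
  Insert both into Delta R^q = q R^(q-1) Delta R + q (q-1) R^(q-2) |grad R|^2.\<close>

lemma klaplacian_pow:
  fixes y :: "real^'n::finite"
  assumes "0 \<le> s" "y \<in> sreg s"
  shows "klaplacian (\<lambda>y s. (s + y \<bullet> y) powr q) y s =
     2 * q * (real CARD('n) + 2 * q - 2) * (s + y \<bullet> y) powr (q - 1)
     - 4 * q * (q - 1) * s * (s + y \<bullet> y) powr (q - 2)"
proof -
  define R where "R = s + y \<bullet> y"
  have R: "R > 0" using assms by (simp add: R_def sreg_def)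
  have 1: "kpartial i (\<lambda>y s. (s + y \<bullet> y) powr q) z s = 2 * q * z $ i * (s + z \<bullet> z) powr (q - 1)"
    if "z \<in> sreg s" for i z
    using DERIV_imp_deriv[OF has_deriv_pow[OF that]] by (simp add: kpartial_def partial_def)
  have 2: "kpartial i (kpartial i (\<lambda>y s. (s + y \<bullet> y) powr q)) y s
        = 2 * q * R powr (q - 1) + 4 * q * (q - 1) * R powr (q - 2) * (y $ i)\<^sup>2" for i
  proof -
    have "kpartial i (kpartial i (\<lambda>y s. (s + y \<bullet> y) powr q)) y s
        = partial i (\<lambda>z. 2 * q * z $ i * (s + z \<bullet> z) powr (q - 1)) y"
      unfolding kpartial_def[of i "kpartial i (\<lambda>y s. (s + y \<bullet> y) powr q)"]
      by (rule partial_cong_open[OF open_sreg assms(2)]) (rule 1)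
    moreover have "((\<lambda>t. 2 * q * (y + t *\<^sub>R axis i 1) $ i
            * (s + (y + t *\<^sub>R axis i 1) \<bullet> (y + t *\<^sub>R axis i 1)) powr (q - 1))
         has_real_derivative 2 * q * R powr (q - 1)
             + 2 * q * y $ i * (2 * (q - 1) * y $ i * R powr (q - 1 - 1))) (at 0)"
      unfolding R_def
      by (rule DERIV_cong, rule DERIV_mult[OF _ has_deriv_pow[OF assms(2)]])
        (auto intro!: derivative_eq_intros)
    ultimately show ?thesis
      by (simp add: partial_def DERIV_imp_deriv power2_eq_square algebra_simps)
  qed
  have yy: "(\<Sum>i\<in>UNIV. (y $ i)\<^sup>2) = R - s"
    by (simp add: R_def inner_vec_def power2_eq_square)
  have "klaplacian (\<lambda>y s. (s + y \<bullet> y) powr q) y s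
      = 2 * q * R powr (q - 1) * real CARD('n) + 4 * q * (q - 1) * R powr (q - 2) * (\<Sum>i\<in>UNIV. (y $ i)\<^sup>2)"
    unfolding klaplacian_eq 2 sum.distrib by (simp flip: sum_distrib_left)
  moreover have "R powr (q - 1) = R * R powr (q - 2)"
    using powr_add[of R 1 "q - 2"] R by simp
  ultimately show ?thesis
    unfolding yy R_def[symmetric] by algebra
qed

text \<open>Strong induction, because one Laplacian produces two lower powers of the base. The first
  is the power treated by the formula for j - 1, the second the one for j - 2, to which one more
  explicit Laplacian is then applied.\<close>

lemma klaplacian_funpow_pow:
  fixes y :: "real^'n::finite"
  assumes "0 \<le> s" "y \<in> sreg s"
  shows "(klaplacian ^^ j) (\<lambda>y s. (s + y \<bullet> y) powr (real j - real CARD('n) / 2)) y s =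
     pochhammer (real CARD('n) / 2 - real j) (2 * j) * (-4 * s) ^ j
       * (s + y \<bullet> y) powr (- real CARD('n) / 2 - real j)"
  using assms(2)
proof (induction j arbitrary: y rule: less_induct)
  case (less j)
  define N where "N = real CARD('n) / 2"
  define P where "P q = (\<lambda>(y::real^'n) s. (s + y \<bullet> y) powr q)" for q
  have kP: "kernel (P q)" for q unfolding P_def by (rule kernel.pow)
  have lapP: "klaplacian (P q) y s = 4 * q * (N + q - 1) * P (q - 1) y s - 4 * q * (q - 1) * s * P (q - 2) y s"
    if "y \<in> sreg s" for q y
    using klaplacian_pow[OF assms(1) that, of q] by (simp add: P_def N_def algebra_simps)
  have IH: "(klaplacian ^^ i) (P (real i - N)) y s = pochhammer (N - real i) (2 * i) * (-4 * s) ^ i * P (- N - real i) y s"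
    if "i < j" "y \<in> sreg s" for i y
    using less.IH[OF that] by (simp add: P_def N_def)
  have "(klaplacian ^^ j) (P (real j - N)) y s = pochhammer (N - real j) (2 * j) * (-4 * s) ^ j * P (- N - real j) y s"
  proof (cases j)
    case 0
    then show ?thesis by simp
  next
    case (Suc i)
    define a where "a = N - real j"
    have q: "real j - N = - a" and i: "real i = N - a - 1" by (auto simp: a_def Suc)
    have "(klaplacian ^^ j) (P (- a)) y s = (klaplacian ^^ i) (klaplacian (P (- a))) y s"
      by (simp add: Suc funpow_swap1)
    \<comment> \<open>The running parameter is called \<open>u\<close>, so that the factor
      \<open>s\<close> in the coefficient is a constant and linearity applies. The equality holds
      only at parameter value \<open>s\<close>, which is why the Laplacians are unfolded to that
      fixed value.\<close>
    also have "\<dots> = (klaplacian ^^ i) (\<lambda>y u. (- 4 * a * i) * P (- a - 1) y u + (- 4 * a * (a + 1) * s) * P (- a - 2) y u) y s"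
      unfolding klaplacian_funpow
      by (rule laplacian_funpow_cong_open[OF open_sreg less.prems]) (simp add: lapP i algebra_simps)
    also have "\<dots> = (- 4 * a * i) * (klaplacian ^^ i) (P (- a - 1)) y s
          + (- 4 * a * (a + 1) * s) * (klaplacian ^^ i) (P (- a - 2)) y s"
      by (rule klaplacian_funpow_lincomb[OF kP kP assms(1) less.prems])
    also have "(klaplacian ^^ i) (P (- a - 1)) y s = pochhammer (a + 1) (2 * i) * (-4 * s) ^ i * P (- N - real i) y s"
      using IH[of i y] less.prems by (simp add: i Suc)
    finally have A: "(klaplacian ^^ j) (P (- a)) y s =
        (- 4 * a * i) * (pochhammer (a + 1) (2 * i) * (-4 * s) ^ i * P (- N - real i) y s)
         + (- 4 * a * (a + 1) * s) * (klaplacian ^^ i) (P (- a - 2)) y s" .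
    have Poch: "pochhammer a (2 * j) = a * pochhammer (a + 1) (2 * i) * (a + 1 + 2 * i)"
      using pochhammer_rec[of a "Suc (2 * i)"] pochhammer_Suc[of "a + 1" "2 * i"] Suc by simp
    show ?thesis
    proof (cases i)
      \<comment> \<open>With \<open>i = 0\<close> the first term has coefficient 0, and no Laplacian
        remains to be applied to the second.\<close>
      case 0
      then have e: "- a - 2 = - N - real j" and j: "j = 1"
        using i Suc by simp_all
      show ?thesis
        unfolding q A a_def[symmetric] Poch e using 0 by (simp add: j)
    next
      case (Suc k)
      have k: "real k = N - a - 2" using i by (simp add: Suc)
      have "(klaplacian ^^ i) (P (- a - 2)) y s = klaplacian ((klaplacian ^^ k) (P (- a - 2))) y s"
        by (simp add: Suc)
      \<comment> \<open>The summand \<open>0 * P 0 y u\<close> only gives the term the shape that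
        \<open>klaplacian_lincomb\<close> expects.\<close>
      also have "\<dots> = klaplacian (\<lambda>y u. (pochhammer (a + 2) (2 * k) * (-4 * s) ^ k) * P (- N - real k) y u + 0 * P 0 y u) y s"
        unfolding klaplacian_def[of "(klaplacian ^^ k) _"] klaplacian_def[of "\<lambda>y u. _ y u + _ y u"]
        using less.prems IH[of k] by (intro laplacian_cong_open[OF open_sreg[of s]]) (auto simp: k \<open>j = Suc i\<close> Suc)
      also have "\<dots> = (pochhammer (a + 2) (2 * k) * (-4 * s) ^ k) * klaplacian (P (- N - real k)) y s"
        using klaplacian_lincomb[OF kP kP assms(1) less.prems, of _ _ 0] by simp
      also have "\<dots> = pochhammer (a + 2) (2 * k) * (-4 * s) ^ k * 
           (4 * (N + real k) * (real k + 1) * P (- N - real i) y s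
            - 4 * (N + real k) * (N + real k + 1) * s * P (- N - real j) y s)"
        by (simp add: lapP less.prems \<open>j = Suc i\<close> Suc algebra_simps)
      finally have B: "(klaplacian ^^ i) (P (- a - 2)) y s = pochhammer (a + 2) (2 * k) * (-4 * s) ^ k * 
           (4 * (N + real k) * (real k + 1) * P (- N - real i) y s
            - 4 * (N + real k) * (N + real k + 1) * s * P (- N - real j) y s)" .
      have 1: "pochhammer (a + 1) (2 * i) = (a + 1) * pochhammer (a + 2) (2 * k) * (a + 2 + 2 * real k)"
        using pochhammer_rec[of "a + 1" "Suc (2 * k)"] pochhammer_Suc[of "a + 2" "2 * k"] Suc
        by (simp add: add.assoc)
      have 2: "real i = real k + 1" "(-4 * s) ^ i = (-4 * s) * (-4 * s) ^ k"
        "(-4 * s) ^ j = (-4 * s) * ((-4 * s) * (-4 * s) ^ k)" using Suc \<open>j = Suc i\<close> by simp_all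
      have 3: "N + real k = a + 2 + 2 * real k" using k by simp
      \<comment> \<open>Here \<open>c\<close> stands for k, \<open>p\<close> for the inner
        Pochhammer factor, \<open>T\<close> for (-4s)^k, and \<open>Q1\<close>, \<open>Q2\<close>
        for the powers with exponents -N-i and -N-j. The two contributions to \<open>Q1\<close>
        cancel.\<close>
      have "(- 4 * a * (c + 1)) * ((a + 1) * p * (a + 2 + 2 * c) * (-4 * s * T) * Q1) +
          (- 4 * a * (a + 1) * s) * (p * T * (4 * (a + 2 + 2 * c) * (c + 1) * Q1
            - 4 * (a + 2 + 2 * c) * (a + 2 + 2 * c + 1) * s * Q2))
          = a * ((a + 1) * p * (a + 2 + 2 * c)) * (a + 1 + 2 * (c + 1)) * (-4 * s * (-4 * s * T)) * Q2"
        for c p T Q1 Q2 :: real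
        by algebra
      then show ?thesis
        unfolding q A B Poch a_def[symmetric] of_nat_mult of_nat_numeral 1 2 3 .
    qed
  qed
  then show ?case by (simp add: P_def N_def)
qed

section \<open>Lipschitz bounds away from the singularity\<close>

definition kdom :: "real \<Rightarrow> real \<Rightarrow> ((real^'n::finite) \<times> real) set" where
  "kdom \<delta> R = {(y, s). 0 \<le> s \<and> s \<le> R \<and> norm y \<le> R \<and> \<delta> \<le> s + y \<bullet> y}"

text \<open>The set \<open>kdom\<close> need not be convex, so the mean value theorem is used here,
  on an interval of values of the base s + |y|^2. The derivative is bounded there by
  compactness.\<close>

lemma powr_lipschitz:
  fixes q \<delta> M :: real
  assumes "0 < \<delta>"
  shows "\<exists>B\<ge>0. \<forall>s\<in>{\<delta>..M}. \<forall>t\<in>{\<delta>..M}. \<bar>s powr q - t powr q\<bar> \<le> B * \<bar>s - t\<bar>"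
proof -
  have "continuous_on {\<delta>..M} (\<lambda>s. q * s powr (q - 1))"
    using assms by (intro continuous_intros) auto
  then have "bounded ((\<lambda>s. q * s powr (q - 1)) ` {\<delta>..M})"
    by (intro compact_imp_bounded compact_continuous_image) auto
  then obtain B where B: "B > 0" "\<And>s. s \<in> {\<delta>..M} \<Longrightarrow> norm (q * s powr (q - 1)) \<le> B"
    unfolding bounded_pos by blast
  have "norm (s powr q - t powr q) \<le> B * norm (s - t)" if "s \<in> {\<delta>..M}" "t \<in> {\<delta>..M}" for s t
  proof (rule field_differentiable_bound[OF convex_real_interval(5) _ B(2) that])
    fix z assume "z \<in> {\<delta>..M}"
    then show "((\<lambda>s. s powr q) has_real_derivative q * z powr (q - 1)) (at z within {\<delta>..M})"
      using assms by (auto intro!: has_real_derivative_powr[THEN has_field_derivative_at_within])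
  qed
  with B(1) show ?thesis by (intro exI[of _ B]) (auto simp: less_imp_le)
qed

lemma sq_norm_diff_le:
  fixes y z :: "'a::real_inner"
  assumes "norm y \<le> R" "norm z \<le> R"
  shows "\<bar>y \<bullet> y - z \<bullet> z\<bar> \<le> 2 * R * norm (y - z)"
proof -
  have "y \<bullet> y - z \<bullet> z = (y + z) \<bullet> (y - z)"
    by (simp add: inner_add_left inner_diff_right inner_commute[of z y])
  also have "\<bar>\<dots>\<bar> \<le> norm (y + z) * norm (y - z)"
    by (rule Cauchy_Schwarz_ineq2)
  also have "\<dots> \<le> (2 * R) * norm (y - z)"
    using norm_triangle_ineq[of y z] assms by (intro mult_right_mono) auto
  finally show ?thesis .
qed

text \<open>The bound on the values is carried along because the Lipschitz constant of a product
  depends on it.\<close>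

definition kernel_bound :: "real \<Rightarrow> real \<Rightarrow> real \<Rightarrow> (real^'n::finite \<Rightarrow> real \<Rightarrow> real) \<Rightarrow> bool" where
  "kernel_bound \<delta> R B K \<longleftrightarrow> 0 \<le> B \<and> (\<forall>y s. (y, s) \<in> kdom \<delta> R \<longrightarrow> \<bar>K y s\<bar> \<le> B) \<and>
     (\<forall>y s z t. (y, s) \<in> kdom \<delta> R \<longrightarrow> (z, t) \<in> kdom \<delta> R \<longrightarrow>
        \<bar>K y s - K z t\<bar> \<le> B * (norm (y - z) + \<bar>s - t\<bar>))"

lemma kernel_boundD:
  assumes "kernel_bound \<delta> R B K"
  shows "0 \<le> B" "(y, s) \<in> kdom \<delta> R \<Longrightarrow> \<bar>K y s\<bar> \<le> B"
    "(y, s) \<in> kdom \<delta> R \<Longrightarrow> (z, t) \<in> kdom \<delta> R \<Longrightarrow> \<bar>K y s - K z t\<bar> \<le> B * (norm (y - z) + \<bar>s - t\<bar>)"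
  using assms by (simp_all add: kernel_bound_def)

lemma kernel_bounded_lipschitz:
  fixes K :: "real^'n::finite \<Rightarrow> real \<Rightarrow> real"
  assumes "kernel K" "0 < \<delta>" "0 \<le> R"
  shows "\<exists>B. kernel_bound \<delta> R B K"
  using assms(1)
proof induction
  case (const c)
  show ?case by (intro exI[of _ "\<bar>c\<bar>"]) (auto simp: kernel_bound_def)
next
  case (coord i)
  have "\<bar>y $ i\<bar> \<le> R + 1" if "norm y \<le> R" for y :: "real^'n"
    using component_le_norm_cart[of y i] that by linarith
  moreover have "\<bar>y $ i - z $ i\<bar> \<le> (R + 1) * (norm (y - z) + \<bar>s - t\<bar>)" for y z :: "real^'n" and s t :: real
  proof -
    have "\<bar>y $ i - z $ i\<bar> \<le> norm (y - z) + \<bar>s - t\<bar>"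
      using component_le_norm_cart[of "y - z" i] by simp
    also have "\<dots> \<le> (R + 1) * (norm (y - z) + \<bar>s - t\<bar>)"
      using assms(3) mult_right_mono[of 1 "R + 1" "norm (y - z) + \<bar>s - t\<bar>"] by simp
    finally show ?thesis .
  qed
  ultimately show ?case
    using assms(3) by (intro exI[of _ "R + 1"]) (auto simp: kernel_bound_def kdom_def)
next
  case (pow q)
  define M where "M = R + R * R"
  obtain B where B: "B \<ge> 0"
    "\<And>s t. s \<in> {\<delta>..M} \<Longrightarrow> t \<in> {\<delta>..M} \<Longrightarrow> \<bar>s powr q - t powr q\<bar> \<le> B * \<bar>s - t\<bar>"
    using powr_lipschitz[OF assms(2), where M = M and q = q] by meson
  have rng: "s + y \<bullet> y \<in> {\<delta>..M}" if "(y, s) \<in> kdom \<delta> R" for y :: "real^'n" and s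
    using that by (auto simp: kdom_def M_def dot_square_norm power2_eq_square intro!: add_mono mult_mono)
  \<comment> \<open>One constant for both bounds: the base differs from \<delta> by at most
    \<open>M\<close>, which controls the values, and it is itself Lipschitz with a constant at most
    1 + 2R.\<close>
  define C where "C = \<delta> powr q + B * (1 + M + 2 * R)"
  have M: "M \<ge> 0" using assms by (simp add: M_def)
  have C: "C \<ge> 0" using B(1) assms M by (simp add: C_def)
  have "\<bar>(s + y \<bullet> y) powr q\<bar> \<le> C" if "(y, s) \<in> kdom \<delta> R" for y :: "real^'n" and s
  proof -
    have "\<bar>(s + y \<bullet> y) powr q - \<delta> powr q\<bar> \<le> B * \<bar>s + y \<bullet> y - \<delta>\<bar>"
      using rng[OF that] by (intro B(2)) auto
    also have "\<dots> \<le> B * (1 + M + 2 * R)"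
      using rng[OF that] B(1) assms by (intro mult_left_mono) auto
    finally show ?thesis by (simp add: C_def)
  qed
  moreover have "\<bar>(s + y \<bullet> y) powr q - (t + z \<bullet> z) powr q\<bar> \<le> C * (norm (y - z) + \<bar>s - t\<bar>)"
    if "(y, s) \<in> kdom \<delta> R" "(z, t) \<in> kdom \<delta> R" for y z :: "real^'n" and s t
  proof -
    have "\<bar>(s + y \<bullet> y) powr q - (t + z \<bullet> z) powr q\<bar> \<le> B * \<bar>(s + y \<bullet> y) - (t + z \<bullet> z)\<bar>"
      by (intro B(2) rng that)
    also have "\<dots> \<le> B * (\<bar>s - t\<bar> + 2 * R * norm (y - z))"
      using sq_norm_diff_le[of y R z] that B(1) by (intro mult_left_mono) (auto simp: kdom_def)
    also have "\<dots> \<le> B * ((1 + M + 2 * R) * (norm (y - z) + \<bar>s - t\<bar>))"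
    proof (intro mult_left_mono B(1))
      have "0 \<le> (1 + M) * norm (y - z) + (M + 2 * R) * \<bar>s - t\<bar>"
        using M assms by simp
      then show "\<bar>s - t\<bar> + 2 * R * norm (y - z) \<le> (1 + M + 2 * R) * (norm (y - z) + \<bar>s - t\<bar>)"
        by (simp add: algebra_simps)
    qed
    also have "\<dots> \<le> C * (norm (y - z) + \<bar>s - t\<bar>)"
      unfolding C_def mult.assoc[symmetric] by (intro mult_right_mono) auto
    finally show ?thesis .
  qed
  ultimately show ?case using C by (intro exI[of _ C]) (auto simp: kernel_bound_def)
next
  case (add K L)
  then obtain B C where B: "kernel_bound \<delta> R B K" and C: "kernel_bound \<delta> R C L" by blast
  note K = kernel_boundD(2-)[OF B] and L = kernel_boundD(2-)[OF C]
  have "\<bar>K y s + L y s\<bar> \<le> B + C" if "(y, s) \<in> kdom \<delta> R" for y s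
    using K(1)[OF that] L(1)[OF that] by linarith
  moreover have "\<bar>K y s + L y s - (K z t + L z t)\<bar> \<le> (B + C) * (norm (y - z) + \<bar>s - t\<bar>)"
    if "(y, s) \<in> kdom \<delta> R" "(z, t) \<in> kdom \<delta> R" for y s z t
    using K(2)[OF that] L(2)[OF that] unfolding distrib_right[of B C] by linarith
  ultimately show ?case using kernel_boundD(1)[OF B] kernel_boundD(1)[OF C] by (intro exI[of _ "B + C"]) (auto simp: kernel_bound_def)
next
  case (mult K L)
  then obtain B C where B: "kernel_bound \<delta> R B K" and C: "kernel_bound \<delta> R C L" by blast
  note K = kernel_boundD(2-)[OF B] and L = kernel_boundD(2-)[OF C]
  have B0: "0 \<le> B" "0 \<le> C" using B C kernel_boundD(1) by blast+
  have "\<bar>K y s * L y s\<bar> \<le> 2 * B * C" if "(y, s) \<in> kdom \<delta> R" for y s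
  proof -
    have "\<bar>K y s * L y s\<bar> \<le> B * C"
      unfolding abs_mult using K(1)[OF that] L(1)[OF that] B0 by (intro mult_mono) auto
    also have "\<dots> \<le> 2 * B * C" using B0 by simp
    finally show ?thesis .
  qed
  moreover have "\<bar>K y s * L y s - K z t * L z t\<bar> \<le> 2 * B * C * (norm (y - z) + \<bar>s - t\<bar>)"
    if "(y, s) \<in> kdom \<delta> R" "(z, t) \<in> kdom \<delta> R" for y s z t
  proof -
    have "K y s * L y s - K z t * L z t = K y s * (L y s - L z t) + (K y s - K z t) * L z t"
      by (simp add: algebra_simps)
    also have "\<bar>\<dots>\<bar> \<le> \<bar>K y s\<bar> * \<bar>L y s - L z t\<bar> + \<bar>K y s - K z t\<bar> * \<bar>L z t\<bar>"
      unfolding abs_mult[symmetric] by (rule abs_triangle_ineq)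
    also have "\<dots> \<le> B * (C * (norm (y - z) + \<bar>s - t\<bar>)) + (B * (norm (y - z) + \<bar>s - t\<bar>)) * C"
      using K L that B0 by (intro add_mono mult_mono) auto
    finally show ?thesis by (simp add: algebra_simps)
  qed
  ultimately show ?case using B0 by (intro exI[of _ "2 * B * C"]) (auto simp: kernel_bound_def)
next
  case (cong K L)
  then obtain B where B: "kernel_bound \<delta> R B K" by blast
  have "L y s = K y s" if "(y, s) \<in> kdom \<delta> R" for y s
    using that assms(2) cong.hyps(2) by (auto simp: kdom_def sreg_def)
  with B have "kernel_bound \<delta> R B L" by (simp add: kernel_bound_def)
  then show ?case by blast
qed

lemma kernel_continuous_on:
  fixes K :: "real^'n::finite \<Rightarrow> real \<Rightarrow> real"
  assumes "kernel K" "0 \<le> s"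
  shows "continuous_on (sreg s) (\<lambda>y. K y s)"
  using assms(1)
proof induction
  case (pow q)
  show ?case by (intro continuous_intros) (auto simp: sreg_def)
next
  case (cong K L)
  then show ?case using assms(2) by (metis continuous_on_cong)
qed (auto intro!: continuous_intros)

section \<open>Series of shifted kernels\<close>

text \<open>The \<open>a j\<close> are the centres and the \<open>\<sigma> j\<close> the
  concentrations. Both are summable because a Lipschitz kernel changes by at most a multiple of
  \<open>norm (a j) + \<sigma> j\<close> when the singular kernel at 0 is replaced by the j-th
  shifted and smoothed one.\<close>

locale shifts =
  fixes a :: "nat \<Rightarrow> real^'n::finite" and \<sigma> :: "nat \<Rightarrow> real"
  assumes sigma_pos: "\<sigma> j > 0"
    and summable_a: "summable (\<lambda>j. norm (a j))"
    and summable_sigma: "summable \<sigma>"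
begin

definition shift_diff :: "(real^'n \<Rightarrow> real \<Rightarrow> real) \<Rightarrow> nat \<Rightarrow> real^'n \<Rightarrow> real" where
  "shift_diff K j x = K (x - a j) (\<sigma> j) - K x 0"

definition shift_sum :: "(real^'n \<Rightarrow> real \<Rightarrow> real) \<Rightarrow> real^'n \<Rightarrow> real" where
  "shift_sum K x = (\<Sum>j. shift_diff K j x)"

lemma shift_in_sreg [simp]: "x - a j \<in> sreg (\<sigma> j)"
  using sigma_pos[of j] inner_ge_zero[of "x - a j"] unfolding sreg_def by (simp only: mem_Collect_eq)

lemma sreg_0 [simp]: "x \<in> sreg 0 \<longleftrightarrow> x \<noteq> 0"
  by (simp add: sreg_def)

section \<open>Locally uniform convergence\<close>

text \<open>For late j the points \<open>(x - a j, \<sigma> j)\<close> and \<open>(x, 0)\<close> lie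
  in a common \<open>kdom\<close>, uniformly for x in the annulus, and the Lipschitz bound applies.
  Early centres may lie in the annulus itself, hence only an eventual bound.\<close>

lemma shift_diff_bound:
  assumes "kernel K" "0 < \<delta>"
  shows "\<exists>B. eventually (\<lambda>j. \<forall>x. \<delta> < norm x \<and> norm x < R \<longrightarrow>
            norm (shift_diff K j x) \<le> B * (norm (a j) + \<sigma> j)) sequentially"
proof -
  \<comment> \<open>Once \<open>norm (a j) < \<delta> / 2\<close>, the shifted point keeps distance
    \<delta>/2 from 0. The maximum in \<open>R'\<close> guards against a negative
    \<open>R\<close>.\<close>
  define \<delta>' where "\<delta>' = (\<delta> / 2)\<^sup>2"
  define R' where "R' = max R 0 + 1"
  have pos: "\<delta>' > 0" "R' \<ge> 0" using assms by (auto simp: \<delta>'_def R'_def)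
  obtain B where B: "\<And>y s z t. (y, s) \<in> kdom \<delta>' R' \<Longrightarrow> (z, t) \<in> kdom \<delta>' R' \<Longrightarrow>
      \<bar>K y s - K z t\<bar> \<le> B * (norm (y - z) + \<bar>s - t\<bar>)"
    using kernel_bounded_lipschitz[OF assms(1) pos] kernel_boundD(3) by metis
  have "(\<lambda>j. norm (a j)) \<longlonglongrightarrow> 0" "\<sigma> \<longlonglongrightarrow> 0"
    using summable_a summable_sigma by (auto intro: summable_LIMSEQ_zero)
  then have "eventually (\<lambda>j. norm (a j) < \<delta> / 2) sequentially" "eventually (\<lambda>j. norm (a j) < 1) sequentially"
    "eventually (\<lambda>j. \<sigma> j < 1) sequentially"
    using assms by (auto intro: order_tendstoD(2) half_gt_zero simp del: less_divide_eq_numeral1)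
  then have "eventually (\<lambda>j. \<forall>x. \<delta> < norm x \<and> norm x < R \<longrightarrow>
            norm (shift_diff K j x) \<le> B * (norm (a j) + \<sigma> j)) sequentially"
  proof eventually_elim
    case (elim j)
    show ?case
    proof (intro allI impI)
      fix x :: "real^'n" assume x: "\<delta> < norm x \<and> norm x < R"
      have "\<delta> / 2 \<le> norm (x - a j)" using x elim norm_triangle_ineq2[of x "a j"] by linarith
      then have "\<delta>' \<le> (x - a j) \<bullet> (x - a j)" "\<delta>' \<le> x \<bullet> x"
        using x assms by (auto simp: \<delta>'_def dot_square_norm intro!: power_mono)
      moreover have "norm (x - a j) \<le> R'" 
        using x elim norm_triangle_ineq4[of x "a j"] unfolding R'_def by linarith
      ultimately have "(x - a j, \<sigma> j) \<in> kdom \<delta>' R'" "(x, 0) \<in> kdom \<delta>' R'"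
        using sigma_pos[of j] elim x by (auto simp: kdom_def R'_def)
      from B[OF this] show "norm (shift_diff K j x) \<le> B * (norm (a j) + \<sigma> j)"
        using sigma_pos[of j] by (simp add: shift_diff_def)
    qed
  qed
  then show ?thesis by blast
qed

lemma shift_uniform_limit:
  assumes "kernel K" "0 < \<delta>"
  shows "uniform_limit {x. \<delta> < norm x \<and> norm x < R} (\<lambda>n x. \<Sum>j<n. shift_diff K j x) (shift_sum K) sequentially"
proof -
  obtain B where B: "eventually (\<lambda>j. \<forall>x. \<delta> < norm x \<and> norm x < R \<longrightarrow>
            norm (shift_diff K j x) \<le> B * (norm (a j) + \<sigma> j)) sequentially"
    using shift_diff_bound[OF assms] by blast
  have "summable (\<lambda>j. B * (norm (a j) + \<sigma> j))"
    by (intro summable_mult summable_add summable_a summable_sigma)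
  from Weierstrass_m_test_ev[OF _ this, of "{x. \<delta> < norm x \<and> norm x < R}" "shift_diff K"] B
  show ?thesis by (simp add: shift_sum_def[abs_def])
qed

lemma shift_sums:
  assumes "kernel K" "x \<noteq> 0"
  shows "(\<lambda>j. shift_diff K j x) sums shift_sum K x"
  unfolding sums_def
  by (rule tendsto_uniform_limitI[OF shift_uniform_limit[OF assms(1), of "norm x / 2" "norm x + 1"]])
    (use assms in auto)

lemma shift_diff_continuous_on:
  assumes "kernel K"
  shows "continuous_on (- {0}) (shift_diff K j)"
  unfolding shift_diff_def
proof (intro continuous_on_diff)
  have "continuous_on (range (\<lambda>x. x - a j)) (\<lambda>y. K y (\<sigma> j))"
    using sigma_pos[of j]
    by (intro continuous_on_subset[OF kernel_continuous_on[OF assms]] image_subsetI shift_in_sreg) simp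
  then have "continuous_on UNIV ((\<lambda>y. K y (\<sigma> j)) \<circ> (\<lambda>x. x - a j))"
    by (intro continuous_on_compose continuous_on_diff continuous_on_id continuous_on_const)
  then show "continuous_on (- {0}) (\<lambda>x. K (x - a j) (\<sigma> j))"
    by (auto intro: continuous_on_subset simp: comp_def)
  show "continuous_on (- {0}) (\<lambda>x. K x 0)"
    by (intro continuous_on_subset[OF kernel_continuous_on[OF assms]]) auto
qed

lemma shift_sum_continuous_on:
  assumes "kernel K"
  shows "continuous_on (- {0}) (shift_sum K)"
proof (subst continuous_on_eq_continuous_at)
  show "open (- {0 :: real^'n})" by auto
  show "\<forall>x\<in>- {0}. isCont (shift_sum K) x"
  proof
    fix x :: "real^'n" assume "x \<in> - {0}"
    define A where "A = {y :: real^'n. norm x / 2 < norm y \<and> norm y < norm x + 1}"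
    have "open A" unfolding A_def by (intro open_Collect_conj open_Collect_less continuous_intros)
    moreover have "x \<in> A" using \<open>x \<in> - {0}\<close> by (auto simp: A_def)
    moreover have "continuous_on A (shift_sum K)"
    proof (rule uniform_limit_theorem)
      show "uniform_limit A (\<lambda>n x. \<Sum>j<n. shift_diff K j x) (shift_sum K) sequentially"
        unfolding A_def using \<open>x \<in> - {0}\<close> by (intro shift_uniform_limit assms) auto
      have "A \<subseteq> - {0}" by (auto simp: A_def)
      then show "\<forall>\<^sub>F n in sequentially. continuous_on A (\<lambda>x. \<Sum>j<n. shift_diff K j x)"
        by (intro always_eventually allI continuous_on_sum continuous_on_subset[OF shift_diff_continuous_on[OF assms]])
    qed simp
    ultimately show "isCont (shift_sum K) x"
      using continuous_on_eq_continuous_at by blast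
  qed
qed

section \<open>Termwise differentiation and smoothness\<close>

lemma shift_diff_has_deriv:
  assumes "kernel K" "x + t *\<^sub>R axis i 1 \<noteq> 0"
  shows "((\<lambda>t. shift_diff K j (x + t *\<^sub>R axis i 1)) has_real_derivative
            shift_diff (kpartial i K) j (x + t *\<^sub>R axis i 1)) (at t)"
proof -
  have "((\<lambda>h. K ((x + t *\<^sub>R axis i 1 - a j) + h *\<^sub>R axis i 1) (\<sigma> j) - K ((x + t *\<^sub>R axis i 1) + h *\<^sub>R axis i 1) 0)
     has_real_derivative shift_diff (kpartial i K) j (x + t *\<^sub>R axis i 1)) (at 0)"
    unfolding shift_diff_def using assms sigma_pos[of j]
    by (intro DERIV_diff kernel_kpartial) auto
  then show ?thesis
    using DERIV_shift[of "\<lambda>t. shift_diff K j (x + t *\<^sub>R axis i 1)" _ 0 t]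
    by (simp add: shift_diff_def algebra_simps)
qed

text \<open>The series of derivatives is again a series of shifted kernels, for
  \<open>kpartial i K\<close>. It therefore converges locally uniformly by the same argument, and
  termwise differentiation is legitimate.\<close>

lemma shift_sum_has_deriv:
  assumes "kernel K" "x \<noteq> 0"
  shows "((\<lambda>t. shift_sum K (x + t *\<^sub>R axis i 1)) has_real_derivative shift_sum (kpartial i K) x) (at 0)"
proof -
  \<comment> \<open>Moving by less than half of |x| keeps the norm between |x|/2 and 3|x|/2, hence
    inside the annulus \<open>A\<close>.\<close>
  define T where "T = {- norm x / 2 <..< norm x / 2}"
  define A where "A = {y :: real^'n. norm x / 3 < norm y \<and> norm y < 2 * norm x}"
  have T: "convex T" "open T" "0 \<in> T" using assms by (auto simp: T_def)
  have TA: "x + t *\<^sub>R axis i 1 \<in> A" if "t \<in> T" for t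
  proof -
    have n: "norm (t *\<^sub>R axis i (1::real) :: real^'n) < norm x / 2" using that by (auto simp: T_def)
    show ?thesis
      using norm_triangle_ineq[of x "t *\<^sub>R axis i 1"] norm_diff_ineq[of x "t *\<^sub>R axis i 1"] n
      unfolding A_def by auto
  qed
  have A0: "0 \<notin> A" by (simp add: A_def)
  have "uniform_limit A (\<lambda>n x. \<Sum>j<n. shift_diff (kpartial i K) j x) (shift_sum (kpartial i K)) sequentially"
    unfolding A_def using assms by (intro shift_uniform_limit kernel_kpartial) auto
  then have "uniform_limit T (\<lambda>n t. \<Sum>j<n. shift_diff (kpartial i K) j (x + t *\<^sub>R axis i 1))
      (\<lambda>t. shift_sum (kpartial i K) (x + t *\<^sub>R axis i 1)) sequentially"
    by (rule uniform_limit_compose') (use TA in auto)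
  then have uc: "uniformly_convergent_on T (\<lambda>n t. \<Sum>j<n. shift_diff (kpartial i K) j (x + t *\<^sub>R axis i 1))"
    by (auto simp: uniformly_convergent_on_def)
  have "((\<lambda>t. \<Sum>j. shift_diff K j (x + t *\<^sub>R axis i 1)) has_real_derivative
          (\<Sum>j. shift_diff (kpartial i K) j (x + 0 *\<^sub>R axis i 1))) (at 0)"
  proof (rule has_field_derivative_series'(2)[OF T(1) _ uc T(3)])
    show "((\<lambda>t. shift_diff K j (x + t *\<^sub>R axis i 1)) has_real_derivative
            shift_diff (kpartial i K) j (x + t *\<^sub>R axis i 1)) (at t within T)" if "t \<in> T" for j t
    proof -
      have "x + t *\<^sub>R axis i 1 \<noteq> 0" using TA[OF that] A0 by (intro notI) simp
      then show ?thesis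
        by (intro has_field_derivative_at_within[OF shift_diff_has_deriv[OF assms(1)]])
    qed
    show "summable (\<lambda>n. shift_diff K n (x + 0 *\<^sub>R axis i 1))"
      using shift_sums[OF assms] by (auto simp: sums_iff)
    show "0 \<in> interior T" using T interior_open by auto
  qed
  then show ?thesis by (simp add: shift_sum_def)
qed

text \<open>Pairs of kernels carry the derivatives along: differentiating \<^term>\<open>corrected_sum V K\<close>
  differentiates \<^term>\<open>V\<close> and \<^term>\<open>K\<close>.\<close>

definition corrected_sum :: "(real^'n \<Rightarrow> real \<Rightarrow> real) \<Rightarrow> (real^'n \<Rightarrow> real \<Rightarrow> real) \<Rightarrow> real^'n \<Rightarrow> real" where
  "corrected_sum V K x = V x 0 + shift_sum K x"

lemma corrected_sum_has_deriv:
  assumes "kernel V" "kernel K" "x \<noteq> 0"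
  shows "((\<lambda>t. corrected_sum V K (x + t *\<^sub>R axis i 1)) has_real_derivative corrected_sum (kpartial i V) (kpartial i K) x) (at 0)"
  unfolding corrected_sum_def using assms by (intro DERIV_add shift_sum_has_deriv kernel_kpartial) auto

lemma partial_corrected_sum:
  assumes "kernel V" "kernel K" "x \<noteq> 0"
  shows "partial i (corrected_sum V K) x = corrected_sum (kpartial i V) (kpartial i K) x"
  unfolding partial_def by (rule DERIV_imp_deriv[OF corrected_sum_has_deriv[OF assms]])

text \<open>All iterated derivatives stay in the same family off the origin, so smoothness reduces
  to continuity and differentiability of a general member.\<close>

lemma iter_partial_corrected_sum:
  assumes "kernel V" "kernel K"
  shows "\<exists>W L. kernel W \<and> kernel L \<and> (\<forall>x. x \<noteq> 0 \<longrightarrow> iter_partial is (corrected_sum V K) x = corrected_sum W L x)"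
proof (induction "is")
  case Nil
  then show ?case using assms by (auto simp: iter_partial_def)
next
  case (Cons i "is")
  then obtain W L where k: "kernel W" "kernel L"
    and eq: "\<And>x. x \<noteq> 0 \<Longrightarrow> iter_partial is (corrected_sum V K) x = corrected_sum W L x" by blast
  have "iter_partial (i # is) (corrected_sum V K) x = corrected_sum (kpartial i W) (kpartial i L) x" if "x \<noteq> 0" for x
  proof -
    have "iter_partial (i # is) (corrected_sum V K) x = partial i (iter_partial is (corrected_sum V K)) x"
      by (simp add: iter_partial_def)
    also have "\<dots> = partial i (corrected_sum W L) x"
      by (rule partial_cong_open[of "- {0}"]) (use that eq in auto)
    finally show ?thesis using partial_corrected_sum[OF k that] by simp
  qed
  then show ?case using k kernel_kpartial(1) by blast
qed

lemma smooth_on_corrected_sum: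
  assumes "kernel V" "kernel K"
  shows "smooth_on (- {0}) (corrected_sum V K)"
  unfolding smooth_on_def
proof (intro allI conjI ballI)
  fix "is" :: "'n list"
  obtain W L where k: "kernel W" "kernel L"
    and eq: "\<And>x. x \<noteq> 0 \<Longrightarrow> iter_partial is (corrected_sum V K) x = corrected_sum W L x"
    using iter_partial_corrected_sum[OF assms] by blast
  have "continuous_on (- {0}) (corrected_sum W L)"
    unfolding corrected_sum_def using k
    by (intro continuous_on_add shift_sum_continuous_on continuous_on_subset[OF kernel_continuous_on]) auto
  then show "continuous_on (- {0}) (iter_partial is (corrected_sum V K))"
    by (rule continuous_on_eq) (use eq in auto)
  fix i and x :: "real^'n" assume x: "x \<in> - {0}"
  have "eventually (\<lambda>t. iter_partial is (corrected_sum V K) (x + t *\<^sub>R axis i 1) = corrected_sum W L (x + t *\<^sub>R axis i 1)) (nhds 0)"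
    using eventually_line_in_open[OF open_Compl[OF closed_singleton] x, of "axis i 1"] eq
    by (auto elim!: eventually_mono)
  then have "((\<lambda>t. iter_partial is (corrected_sum V K) (x + t *\<^sub>R axis i 1)) has_real_derivative
      corrected_sum (kpartial i W) (kpartial i L) x) (at 0)"
    using corrected_sum_has_deriv[OF k, of x i] x by (subst DERIV_cong_ev[OF refl _ refl]) auto
  then show "(\<lambda>t. iter_partial is (corrected_sum V K) (x + t *\<^sub>R axis i 1)) differentiable (at 0)"
    using real_differentiable_def by blast
qed

section \<open>Iterated Laplacians of the corrected series\<close>

lemma shift_sum_sum:
  assumes "finite I" "\<And>i. i \<in> I \<Longrightarrow> kernel (K i)" "x \<noteq> 0"
  shows "shift_sum (\<lambda>y s. \<Sum>i\<in>I. K i y s) x = (\<Sum>i\<in>I. shift_sum (K i) x)"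
proof -
  have "(\<lambda>j. \<Sum>i\<in>I. shift_diff (K i) j x) sums (\<Sum>i\<in>I. shift_sum (K i) x)"
    using assms by (intro sums_sum shift_sums) auto
  then show ?thesis
    by (simp add: sums_iff shift_sum_def shift_diff_def sum_subtractf)
qed

lemma laplacian_corrected_sum:
  assumes "kernel V" "kernel K" "x \<noteq> 0"
  shows "laplacian (corrected_sum V K) x = corrected_sum (klaplacian V) (klaplacian K) x"
proof -
  have "laplacian (corrected_sum V K) x = (\<Sum>i\<in>UNIV. partial i (corrected_sum (kpartial i V) (kpartial i K)) x)"
    unfolding laplacian_def
    by (intro sum.cong refl partial_cong_open[of "- {0}"]) (use assms partial_corrected_sum in auto)
  also have "\<dots> = (\<Sum>i\<in>UNIV. corrected_sum (kpartial i (kpartial i V)) (kpartial i (kpartial i K)) x)"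
    using assms by (intro sum.cong refl partial_corrected_sum kernel_kpartial)
  also have "\<dots> = corrected_sum (klaplacian V) (klaplacian K) x"
    using assms unfolding corrected_sum_def klaplacian_eq[abs_def]
    by (subst shift_sum_sum) (auto simp: sum.distrib intro!: kernel_kpartial)
  finally show ?thesis .
qed

lemma laplacian_funpow_corrected_sum:
  assumes "kernel V" "kernel K" "x \<noteq> 0"
  shows "(laplacian ^^ j) (corrected_sum V K) x = corrected_sum ((klaplacian ^^ j) V) ((klaplacian ^^ j) K) x"
  using assms(3)
proof (induction j arbitrary: x)
  case (Suc j)
  have "(laplacian ^^ Suc j) (corrected_sum V K) x = laplacian (corrected_sum ((klaplacian ^^ j) V) ((klaplacian ^^ j) K)) x"
    unfolding funpow.simps comp_def
    by (rule laplacian_cong_open[of "- {0}"]) (use Suc in auto)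
  then show ?case
    using Suc.prems assms by (simp add: laplacian_corrected_sum kernel_klaplacian_funpow)
qed simp

end

section \<open>Estimates for the bubbles and the solution\<close>

text \<open>Bernoulli's inequality for a negative exponent, from 1 - t <= exp(-t) and ln(1+z) <=
  z.\<close>

lemma one_minus_le_powr_neg:
  fixes z k :: real
  assumes "0 \<le> z" "0 \<le> k"
  shows "1 - k * z \<le> (1 + z) powr (- k)"
proof -
  have "1 - k * z \<le> exp (- k * z)"
    using exp_ge_add_one_self[of "- k * z"] by simp
  also have "\<dots> \<le> exp (- k * ln (1 + z))"
    using assms ln_add_one_self_le_self[of z] by (simp add: mult_left_mono)
  also have "\<dots> = (1 + z) powr (- k)"
    using assms by (simp add: powr_def)
  finally show ?thesis .
qed

text \<open>The convex function t^(-k) lies above its tangent at r. Scaling by r reduces this to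
  \<open>one_minus_le_powr_neg\<close>.\<close>

lemma powr_neg_shift_ge:
  fixes r b k :: real
  assumes "0 < r" "0 \<le> b" "0 \<le> k"
  shows "r powr (- k) - k * b * r powr (- k - 1) \<le> (r + b) powr (- k)"
proof -
  have "r powr (- k) * (1 - k * (b / r)) \<le> r powr (- k) * (1 + b / r) powr (- k)"
    using assms by (intro mult_left_mono one_minus_le_powr_neg) auto
  also have "\<dots> = (r * (1 + b / r)) powr (- k)"
    using assms by (simp add: powr_mult)
  also have "r * (1 + b / r) = r + b"
    using assms by (simp add: field_simps)
  finally show ?thesis
    using assms by (simp add: powr_diff field_simps)
qed

lemma sq_powr:
  fixes r p :: real
  assumes "0 \<le> r"
  shows "(r\<^sup>2) powr p = r powr (2 * p)"
  using powr_powr[of r 2 p] assms by simp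

text \<open>Displacement and smoothing together act like an increase of |x| by \<open>b\<close>,
  since s + |x-a|^2 <= (sqrt s + |x-a|)^2 <= (|x|+b)^2. Being one-sided, the bound is valid even at
  the centre of the bubble, where the difference may be huge.\<close>

lemma bubble_diff_ge:
  fixes x a :: "'a::real_inner"
  assumes "x \<noteq> 0" "0 \<le> s" "norm a + sqrt s \<le> b" "0 \<le> h" "0 < s + (x - a) \<bullet> (x - a)"
  shows "- (2 * h * b * norm x powr (- 2 * h - 1)) \<le>
           (s + (x - a) \<bullet> (x - a)) powr (- h) - (x \<bullet> x) powr (- h)"
proof -
  have b: "0 \<le> b" using assms(2,3) norm_ge_zero[of a] real_sqrt_ge_zero[of s] by linarith
  have "s + (x - a) \<bullet> (x - a) = (sqrt s)\<^sup>2 + (norm (x - a))\<^sup>2"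
    using assms by (simp add: dot_square_norm)
  also have "\<dots> \<le> (sqrt s + norm (x - a))\<^sup>2"
    using assms by (simp add: power2_sum)
  also have "\<dots> \<le> (norm x + b)\<^sup>2"
    using norm_triangle_ineq4[of x a] assms by (intro power_mono) auto
  finally have "((norm x + b)\<^sup>2) powr (- h) \<le> (s + (x - a) \<bullet> (x - a)) powr (- h)"
    using assms by (intro powr_mono2') auto
  moreover have "((norm x + b)\<^sup>2) powr (- h) = (norm x + b) powr (- (2 * h))"
    using b by (subst sq_powr) auto
  moreover have "(x \<bullet> x) powr (- h) = norm x powr (- (2 * h))"
    unfolding dot_square_norm by (subst sq_powr) auto
  ultimately show ?thesis
    using powr_neg_shift_ge[of "norm x" b "2 * h"] assms b by simp
qed

text \<open>Near 0 the more singular power dominates, and away from 0 the left side is at most 1.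
  With \<open>q = 1 - N\<close> the right side is the harmonic majorant 1 + |x|^(2-n).\<close>

lemma norm_powr_le:
  fixes x :: "'a::real_inner"
  assumes "x \<noteq> 0" "2 * q \<le> p" "p \<le> 0"
  shows "norm x powr p \<le> 1 + (x \<bullet> x) powr q"
proof (cases "norm x \<le> 1")
  case True
  have "norm x powr p \<le> norm x powr (2 * q)"
    using assms True by (intro powr_mono') auto
  also have "\<dots> = (x \<bullet> x) powr q"
    unfolding dot_square_norm by (subst sq_powr) auto
  finally show ?thesis by simp
next
  case False
  then have "norm x powr p \<le> 1 powr p"
    using assms by (intro powr_mono2') auto
  then show ?thesis by (simp add: add_increasing2)
qed

text \<open>Split off one factor: v^(p-1) and 1 are both at most (1+v)^(p-1). This lets the total of
  the far sources, at most 1, be absorbed by the 1 in the lower bound of the solution.\<close>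

lemma one_plus_powr_le:
  fixes v p :: real
  assumes "0 < v" "1 \<le> p"
  shows "1 + v powr p \<le> (1 + v) powr p"
proof -
  have "v powr p = v * v powr (p - 1)"
    using powr_add[of v 1 "p - 1"] assms by simp
  also have "\<dots> \<le> v * (1 + v) powr (p - 1)"
    using assms by (intro mult_left_mono powr_mono2) auto
  finally have "1 + v powr p \<le> (1 + v) powr (p - 1) + v * (1 + v) powr (p - 1)"
    using ge_one_powr_ge_zero[of "1 + v" "p - 1"] assms by linarith
  also have "\<dots> = (1 + v) powr p"
    using powr_add[of "1 + v" 1 "p - 1"] assms by (simp add: algebra_simps)
  finally show ?thesis .
qed

theorem theorem1p6:
  fixes m :: nat and lam :: real and \<phi> :: "real \<Rightarrow> real"
  assumes "odd m" and "m \<ge> 3"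
    and "2 * m < CARD('n::finite)"
    and "lam \<ge> real CARD('n) / (real CARD('n) - 2 * real m)"
    and "continuous_on {0<..<1} \<phi>"
    and "\<forall>r\<in>{0<..<1}. \<phi> r > 0"
    and "filterlim \<phi> at_top (at_right 0)"
  shows "\<exists>u :: real^'n \<Rightarrow> real.
           smooth_on (- {0}) u \<and>
           (\<forall>x. x \<noteq> 0 \<longrightarrow> u x > 0) \<and>
           (\<forall>x. x \<noteq> 0 \<longrightarrow> 0 \<le> - (laplacian ^^ m) u x \<and> - (laplacian ^^ m) u x \<le> u x powr lam) \<and>
           Limsup (at 0) (\<lambda>x. ereal (u x / \<phi> (norm x))) = \<infinity>"
proof -

  \<comment> \<open>Choice of mass, centres and concentrations\<close>
  define N where "N = real CARD('n) / 2"
  define h where "h = N - real m"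
  have m: "real m \<ge> 3" using assms(2) by simp
  have h: "h > 0" using assms(3) by (simp add: h_def N_def)
  have lam: "lam * h \<ge> N" "lam > 1"
  proof -
    have "lam \<ge> N / h" using assms(4) h by (simp add: h_def N_def field_simps)
    then show "lam * h \<ge> N" using h by (simp add: field_simps)
    moreover have "N > h" using m by (simp add: h_def)
    ultimately have "lam * h > 1 * h" by linarith
    then show "lam > 1" using h by simp
  qed
  define c where "c = pochhammer h (2 * m) * 4 ^ m"
  have c: "c > 0" using h by (simp add: c_def pochhammer_pos)
  \<comment> \<open>The source of a bubble is linear in the mass, while the right-hand side grows
    like its power \<open>lam\<close>. As \<open>lam > 1\<close>, a mass with eps^(lam-1) >= c makes
    the latter win.\<close>
  define eps where "eps = max 1 (c powr (1 / (lam - 1)))"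
  have eps: "eps \<ge> 1" "eps * c \<le> eps powr lam"
  proof -
    show "eps \<ge> 1" by (simp add: eps_def)
    have "c = (c powr (1 / (lam - 1))) powr (lam - 1)"
      using lam c by (simp add: powr_powr)
    also have "\<dots> \<le> eps powr (lam - 1)"
      using lam by (intro powr_mono2) (auto simp: eps_def)
    finally show "eps * c \<le> eps powr lam"
      using powr_add[of eps 1 "lam - 1"] \<open>eps \<ge> 1\<close> by (simp add: mult_left_mono)
  qed
  obtain k0 :: 'n where True by simp
  define a :: "nat \<Rightarrow> real^'n" where "a j = (1 / 2) ^ (j + 1) *\<^sub>R axis k0 1" for j
  have norm_a: "norm (a j) = (1 / 2) ^ (j + 1)" for j by (simp add: a_def)
  \<comment> \<open>Balls of radius \<open>\<delta> j\<close> about \<open>a j\<close> are disjoint: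
    for i < j the centres are at least 2^(-i-2) apart, and the two radii add up to at most 2^(-i-3)
    + 2^(-i-4).\<close>
  define \<delta> :: "nat \<Rightarrow> real" where "\<delta> j = (1 / 2) ^ (j + 3)" for j
  have \<delta>_pos: "\<delta> j > 0" for j by (simp add: \<delta>_def)
  have sep: "\<delta> i + \<delta> j \<le> dist (a i) (a j)" if "i < j" for i j
  proof -
    have "a i - a j = ((1 / 2) ^ (i + 1) - (1 / 2) ^ (j + 1)) *\<^sub>R axis k0 1"
      by (simp add: a_def scaleR_diff_left)
    then have "dist (a i) (a j) = \<bar>(1 / 2) ^ (i + 1) - (1 / 2) ^ (j + 1)\<bar>"
      by (simp add: dist_norm)
    moreover have "(1 / 2 :: real) ^ j \<le> (1 / 2) ^ (i + 1)"
      using that by (intro power_decreasing) auto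
    moreover have "(0::real) < (1 / 2) ^ j" by simp
    ultimately show ?thesis unfolding \<delta>_def power_add by (simp add: power3_eq_cube)
  qed
  \<comment> \<open>The first bound gives sqrt s <= |a_j|. The second makes the source at most
    2^(-j-1) outside the ball of radius \<open>\<delta> j\<close>, and the third makes the bubble
    high. All three hold as s tends to 0.\<close>
  have "\<exists>s>0. s \<le> (1 / 4) ^ (j + 1) \<and> eps * c * s ^ m * \<delta> j powr (- 2 * N - 2 * m) \<le> (1 / 2) ^ (j + 1)
          \<and> real j * \<phi> (norm (a j)) \<le> s powr (- h)" for j
  proof -
    have "eventually (\<lambda>s::real. s > 0) (at_right 0)" by (rule eventually_at_right_less)
    moreover have "eventually (\<lambda>s::real. s < (1 / 4) ^ (j + 1)) (at_right 0)"
      by (intro eventually_at_rightI[of 0 "(1 / 4) ^ (j + 1)"]) auto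
    moreover have "eventually (\<lambda>s. eps * c * s ^ m * \<delta> j powr (- 2 * N - 2 * m) < (1 / 2) ^ (j + 1)) (at_right 0)"
    proof (rule order_tendstoD)
      have "((\<lambda>s. eps * c * s ^ m * \<delta> j powr (- 2 * N - 2 * m)) \<longlongrightarrow> eps * c * 0 ^ m * \<delta> j powr (- 2 * N - 2 * m)) (at_right 0)"
        by (intro tendsto_intros)
      then show "((\<lambda>s. eps * c * s ^ m * \<delta> j powr (- 2 * N - 2 * m)) \<longlongrightarrow> 0) (at_right 0)"
        using assms(2) by (simp add: power_0_left)
    qed simp
    moreover have "eventually (\<lambda>s::real. real j * \<phi> (norm (a j)) \<le> s powr (- h)) (at_right 0)"
    proof -
      have "filterlim (\<lambda>s::real. s powr (- h)) at_top (at_right 0)"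
        using h by real_asymp
      then show ?thesis by (simp add: filterlim_at_top)
    qed
    ultimately have "eventually (\<lambda>s. s > 0 \<and> s \<le> (1 / 4) ^ (j + 1) \<and> eps * c * s ^ m * \<delta> j powr (- 2 * N - 2 * m) \<le> (1 / 2) ^ (j + 1)
          \<and> real j * \<phi> (norm (a j)) \<le> s powr (- h)) (at_right (0::real))"
      by eventually_elim auto
    then show ?thesis
      using eventually_happens trivial_limit_at_right_real by blast
  qed
  then obtain \<sigma> where \<sigma>: "\<And>j. \<sigma> j > 0" "\<And>j. \<sigma> j \<le> (1 / 4) ^ (j + 1)"
    "\<And>j. eps * c * \<sigma> j ^ m * \<delta> j powr (- 2 * N - 2 * m) \<le> (1 / 2) ^ (j + 1)"
    "\<And>j. real j * \<phi> (norm (a j)) \<le> \<sigma> j powr (- h)"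
    by metis
  interpret shifts a \<sigma>
  proof
    show "\<sigma> j > 0" for j by (rule \<sigma>)
    show "summable (\<lambda>j. norm (a j))"
      unfolding norm_a power_add by (intro summable_mult2 summable_geometric) auto
    have "summable (\<lambda>j. (1 / 4 :: real) ^ (j + 1))"
      unfolding power_add by (intro summable_mult2 summable_geometric) auto
    then show "summable \<sigma>"
      by (rule summable_comparison_test') (use \<sigma>(1,2) in \<open>auto simp: less_imp_le\<close>)
  qed

  \<comment> \<open>The solution and its lower bound\<close>
  \<comment> \<open>The summands pay, in this order, for the constant 1, for the singular term
    subtracted from one chosen bubble, and for the negative parts of all differences, where the last
    2 is the sum of the 2^(-i).\<close>
  define Cst where "Cst = 1 + eps + eps * (2 * h * 2)"
  define Q where "Q x = 1 + (x \<bullet> x) powr (1 - N)" for x :: "real^'n"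
  define V where "V = (\<lambda>(y::real^'n) s. Cst + Cst * (s + y \<bullet> y) powr (1 - N))"
  define K where "K = (\<lambda>(y::real^'n) s. eps * (s + y \<bullet> y) powr (- h))"
  define u where "u = corrected_sum V K"
  have kV: "kernel V" unfolding V_def by (intro kernel.add kernel.mult kernel.const kernel.pow)
  have kK: "kernel K" unfolding K_def by (intro kernel.mult kernel.const kernel.pow)
  have lower: "1 + eps * (\<sigma> j + (x - a j) \<bullet> (x - a j)) powr (- h) \<le> u x" if x: "x \<noteq> 0" for x j
  proof -
    have Q: "Q x \<ge> 1" by (simp add: Q_def)
    \<comment> \<open>Adding \<open>D i\<close> makes every term of the series nonnegative, so the
      sum is at least its j-th term, which contains the chosen bubble.\<close>
    define D where "D i = eps * (2 * h * (1 / 2) ^ i * Q x)" for i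
    have D: "- D i \<le> shift_diff K i x" for i
    proof -
      have "sqrt (\<sigma> i) \<le> sqrt (((1 / 2) ^ (i + 1))\<^sup>2)"
        using \<sigma>(2)[of i] by (intro real_sqrt_le_mono) (simp add: power_mult_distrib power2_eq_square flip: power_mult_distrib)
      then have "norm (a i) + sqrt (\<sigma> i) \<le> (1 / 2) ^ i" by (simp add: norm_a)
      then have "- (2 * h * (1 / 2) ^ i * norm x powr (- 2 * h - 1)) \<le>
           (\<sigma> i + (x - a i) \<bullet> (x - a i)) powr (- h) - (x \<bullet> x) powr (- h)"
        using x h \<sigma>(1)[of i] by (intro bubble_diff_ge) (auto intro: add_pos_nonneg)
      moreover have "2 * h * (1 / 2) ^ i * norm x powr (- 2 * h - 1) \<le> 2 * h * (1 / 2) ^ i * Q x"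
        unfolding Q_def using x h m by (intro mult_left_mono norm_powr_le) (auto simp: h_def)
      ultimately have "- (2 * h * (1 / 2) ^ i * Q x) \<le>
           (\<sigma> i + (x - a i) \<bullet> (x - a i)) powr (- h) - (x \<bullet> x) powr (- h)"
        by linarith
      then have "eps * - (2 * h * (1 / 2) ^ i * Q x) \<le>
           eps * ((\<sigma> i + (x - a i) \<bullet> (x - a i)) powr (- h) - (x \<bullet> x) powr (- h))"
        using eps by (intro mult_left_mono) auto
      then show ?thesis by (simp add: D_def shift_diff_def K_def algebra_simps)
    qed
    have "D sums (eps * (2 * h * 2 * Q x))"
      unfolding D_def
      by (intro sums_mult sums_mult2) (use geometric_sums[of "1 / 2 :: real"] in simp)
    then have S: "(\<lambda>i. shift_diff K i x + D i) sums (shift_sum K x + eps * (2 * h * 2 * Q x))"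
      by (intro sums_add shift_sums kK x)
    have "shift_diff K j x + D j \<le> shift_sum K x + eps * (2 * h * 2 * Q x)"
      using sum_le_suminf[of "\<lambda>i. shift_diff K i x + D i" "{j}"] S D
      by (simp add: sums_iff) (metis add.commute diff_ge_0_iff_ge diff_minus_eq_add)
    moreover have "D j \<ge> 0" using eps h Q by (simp add: D_def)
    moreover have "shift_diff K j x \<ge> eps * (\<sigma> j + (x - a j) \<bullet> (x - a j)) powr (- h) - eps * Q x"
    proof -
      have "norm x powr (- 2 * h) \<le> Q x"
        unfolding Q_def using x h m by (intro norm_powr_le) (auto simp: h_def)
      then have "(x \<bullet> x) powr (- h) \<le> Q x"
        unfolding dot_square_norm by (subst sq_powr) auto
      then show ?thesis using eps by (simp add: shift_diff_def K_def)
    qed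
    moreover have "V x 0 = Q x + eps * Q x + eps * (2 * h * 2 * Q x)"
      by (simp add: V_def Q_def Cst_def algebra_simps)
    ultimately show ?thesis using Q by (simp add: u_def corrected_sum_def)
  qed

  \<comment> \<open>The sources and the equation for the iterated Laplacian\<close>
  define f where "f x j = eps * c * \<sigma> j ^ m * (\<sigma> j + (x - a j) \<bullet> (x - a j)) powr (- N - m)" for x :: "real^'n" and j
  have lap_u: "(\<lambda>j. f x j) sums (- (laplacian ^^ m) u x)" if x: "x \<noteq> 0" for x
  proof -
    have lapK: "(klaplacian ^^ m) K y s = - (eps * c * s ^ m * (s + y \<bullet> y) powr (- N - m))"
      if "s \<ge> 0" "y \<in> sreg s" for y s
    proof -
      have "(klaplacian ^^ m) K y s = eps * (klaplacian ^^ m) (\<lambda>y s. (s + y \<bullet> y) powr (- h)) y s"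
        unfolding K_def by (rule klaplacian_funpow_cmult[OF kernel.pow that])
      also have "(klaplacian ^^ m) (\<lambda>y s. (s + y \<bullet> y) powr (- h)) y s
          = pochhammer h (2 * m) * (-4 * s) ^ m * (s + y \<bullet> y) powr (- N - m)"
        using klaplacian_funpow_pow[OF that, of m] by (simp add: h_def N_def)
      \<comment> \<open>Oddness of \<open>m\<close> enters here and gives all sources the same
        sign.\<close>
      also have "(-4 * s) ^ m = - (4 ^ m * s ^ m)"
        using power_minus_odd[OF assms(1), of "4 * s"] by (simp only: mult_minus_left power_mult_distrib)
      finally show ?thesis by (simp add: c_def algebra_simps)
    qed
    have lapV: "(klaplacian ^^ m) V x 0 = 0"
    proof -
      \<comment> \<open>A single Laplacian already annihilates the harmonic correction; the
        remaining ones act on 0.\<close>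
      obtain m' where m': "m = Suc m'" using assms(2) by (cases m) auto
      have "klaplacian V y 0 = 0" if "y \<in> - {0}" for y
      proof -
        have y: "y \<in> sreg 0" using that by simp
        have "klaplacian V y 0 = Cst * klaplacian (\<lambda>y s. 1) y 0 + Cst * klaplacian (\<lambda>y s. (s + y \<bullet> y) powr (1 - N)) y 0"
          using klaplacian_lincomb[where K = "\<lambda>_ _. 1" and \<alpha> = Cst and \<beta> = Cst,
              OF kernel.const kernel.pow[of "1 - N"] _ y]
          by (simp add: V_def)
        also have "\<dots> = 0"
          using klaplacian_pow[OF _ y, of "1 - N"]
          by (simp add: klaplacian_def laplacian_def partial_def N_def)
        finally show ?thesis .
      qed
      then have "(klaplacian ^^ m) V x 0 = (laplacian ^^ m') (\<lambda>y. 0) x"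
        unfolding m' funpow_Suc_right comp_def klaplacian_funpow using x
        by (intro laplacian_funpow_cong_open[of "- {0}"]) auto
      also have "\<dots> = 0"
      proof -
        have "(laplacian ^^ m') (\<lambda>y. 0) = (\<lambda>y :: real^'n. 0)"
          by (induction m') (auto simp: laplacian_def partial_def)
        then show ?thesis by simp
      qed
      finally show ?thesis .
    qed
    \<comment> \<open>At parameter 0 the formula vanishes because of the factor s^m, so the
      subtracted singular terms contribute nothing.\<close>
    have "shift_diff ((klaplacian ^^ m) K) j x = - f x j" for j
      using lapK[of 0 x] lapK[of "\<sigma> j" "x - a j"] x m \<sigma>(1)[of j]
      by (simp add: shift_diff_def f_def)
    then have "(\<lambda>j. - f x j) sums (laplacian ^^ m) u x"
      using shift_sums[OF kernel_klaplacian_funpow[OF kK] x, of m] lapV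
      by (simp add: u_def laplacian_funpow_corrected_sum[OF kV kK x] corrected_sum_def)
    from sums_minus[OF this] show ?thesis by simp
  qed

  \<comment> \<open>Far and near sources, and the upper inequality\<close>
  have f_nonneg: "f x j \<ge> 0" for x j
    using eps c \<sigma>(1)[of j] by (simp add: f_def less_imp_le)
  have f_far: "f x j \<le> (1 / 2) ^ (j + 1)" if "\<delta> j \<le> norm (x - a j)" for x j
  proof -
    have "(\<sigma> j + (x - a j) \<bullet> (x - a j)) powr (- N - m) \<le> ((\<delta> j)\<^sup>2) powr (- N - m)"
    proof (rule powr_mono2')
      have "(\<delta> j)\<^sup>2 \<le> (x - a j) \<bullet> (x - a j)"
        unfolding dot_square_norm using that \<delta>_pos[of j] by (intro power_mono) auto
      then show "(\<delta> j)\<^sup>2 \<le> \<sigma> j + (x - a j) \<bullet> (x - a j)" using \<sigma>(1)[of j] by linarith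
    qed (use \<delta>_pos[of j] h m in \<open>auto simp: h_def\<close>)
    also have "\<dots> = \<delta> j powr (- 2 * N - 2 * m)"
      using \<delta>_pos[of j] by (subst sq_powr) (auto simp: algebra_simps)
    finally have "f x j \<le> eps * c * \<sigma> j ^ m * \<delta> j powr (- 2 * N - 2 * m)"
      unfolding f_def using eps c \<sigma>(1)[of j] by (intro mult_left_mono) auto
    with \<sigma>(3)[of j] show ?thesis by linarith
  qed
  \<comment> \<open>Here the largeness of the mass covers the critical exponent, where no concentration would help.\<close>
  have f_near: "f x j \<le> (eps * (\<sigma> j + (x - a j) \<bullet> (x - a j)) powr (- h)) powr lam"
    if "norm (x - a j) < \<delta> j" for x j
  proof -
    define R where "R = \<sigma> j + (x - a j) \<bullet> (x - a j)"
    have R: "\<sigma> j \<le> R" "R > 0" using \<sigma>(1)[of j] by (auto simp: R_def intro: add_pos_nonneg)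
    \<comment> \<open>For R <= 1 a more negative exponent gives a larger power, so
      \<open>lam * h \<ge> N\<close> yields R^(-N) <= R^(-h lam).\<close>
    have "R \<le> 1"
    proof -
      have "\<sigma> j \<le> 1 / 4"
        using \<sigma>(2)[of j] power_decreasing[of 1 "j + 1" "1 / 4 :: real"] by simp
      moreover have "\<delta> j \<le> 1 / 8"
        using power_decreasing[of 3 "j + 3" "1 / 2 :: real"] by (simp add: \<delta>_def power3_eq_cube)
      then have "(norm (x - a j))\<^sup>2 \<le> (1 / 8)\<^sup>2"
        using that by (intro power_mono) auto
      ultimately show ?thesis by (simp add: R_def dot_square_norm power2_eq_square)
    qed
    \<comment> \<open>Bounding the concentration by R trades s^m R^(-N-m) for R^(-N), which is
      scale-invariantly comparable with the bubble at the critical exponent N/h.\<close>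
    have "f x j \<le> eps * c * R ^ m * R powr (- N - m)"
      unfolding f_def R_def[symmetric] using eps c \<sigma>(1)[of j] R
      by (intro mult_right_mono mult_left_mono power_mono) auto
    also have "\<dots> = eps * c * R powr (- N)"
      using R by (simp add: powr_diff powr_realpow)
    also have "\<dots> \<le> eps powr lam * R powr (- h * lam)"
      using eps c R lam \<open>R \<le> 1\<close> by (intro mult_mono powr_mono') (auto simp: mult.commute)
    also have "\<dots> = (eps * R powr (- h)) powr lam"
      using eps R by (simp add: powr_mult powr_powr)
    finally show ?thesis by (simp add: R_def)
  qed
  have upper: "- (laplacian ^^ m) u x \<le> u x powr lam" if x: "x \<noteq> 0" for x
  proof -
    have geo: "(\<lambda>j. (1 / 2 :: real) ^ (j + 1)) sums 1"
      using power_half_series by simp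
    \<comment> \<open>Disjointness leaves at most one ball containing x. If there is none, any index
      serves.\<close>
    have "\<exists>j. \<forall>i. i \<noteq> j \<longrightarrow> \<delta> i \<le> norm (x - a i)"
    proof (rule ccontr)
      assume "\<nexists>j. \<forall>i. i \<noteq> j \<longrightarrow> \<delta> i \<le> norm (x - a i)"
      then obtain i j where ij: "i \<noteq> j" "norm (x - a i) < \<delta> i" "norm (x - a j) < \<delta> j"
        by (metis not_le)
      then have "dist (a i) (a j) < \<delta> i + \<delta> j"
        using dist_triangle3[of "a i" "a j" x] by (simp add: dist_norm)
      then show False
        using sep[of i j] sep[of j i] ij(1) by (cases "i < j") (auto simp: dist_commute)
    qed
    then obtain j where far: "\<And>i. i \<noteq> j \<Longrightarrow> \<delta> i \<le> norm (x - a i)" by blast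
    define v where "v = eps * (\<sigma> j + (x - a j) \<bullet> (x - a j)) powr (- h)"
    have v: "v > 0" using eps shift_in_sreg[of x j] by (auto simp: v_def sreg_def)
    \<comment> \<open>The geometric term is kept at index j as well, so that the comparison series
      is the full geometric series, of sum 1, plus a single spike.\<close>
    have "f x j \<le> (1 / 2) ^ (j + 1) + v powr lam"
    proof (cases "\<delta> j \<le> norm (x - a j)")
      case True
      then show ?thesis using f_far[OF True] by (simp add: add_increasing2)
    next
      case False
      then show ?thesis using f_near[of x j] by (simp add: v_def add_increasing)
    qed
    moreover have "(\<lambda>i. if i = j then v powr lam else 0) sums (v powr lam)"
      by (rule sums_single)
    ultimately have "- (laplacian ^^ m) u x \<le> 1 + v powr lam"
      using f_far[OF far]
      by (intro sums_le[OF _ lap_u[OF x] sums_add[OF geo, of "\<lambda>i. if i = j then v powr lam else 0"]]) auto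
    also have "\<dots> \<le> (1 + v) powr lam"
      using v lam by (intro one_plus_powr_le) auto
    also have "\<dots> \<le> u x powr lam"
      using lower[OF x, of j] v lam by (intro powr_mono2) (auto simp: v_def)
    finally show ?thesis .
  qed

  \<comment> \<open>Growth along the centres\<close>
  have limsup: "Limsup (at 0) (\<lambda>x. ereal (u x / \<phi> (norm x))) = \<infinity>"
  proof (rule ccontr)
    assume "Limsup (at 0) (\<lambda>x. ereal (u x / \<phi> (norm x))) \<noteq> \<infinity>"
    then obtain M :: nat where "Limsup (at 0) (\<lambda>x. ereal (u x / \<phi> (norm x))) < ereal (real M)"
      unfolding less_PInf_Ex_of_nat by blast
    then have ev: "eventually (\<lambda>x. u x / \<phi> (norm x) < real M) (at 0)"
      by (auto dest!: Limsup_lessD)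
    \<comment> \<open>The quotient is tested along the centres: they tend to 0 without reaching it,
      and at \<open>a j\<close> the j-th bubble has height
      \<open>eps * \<sigma> j powr (- h)\<close>, at least j times \<phi> there.\<close>
    have a0: "a j \<noteq> 0" for j using norm_a[of j] by auto
    have "a \<longlonglongrightarrow> 0"
      by (rule tendsto_norm_zero_cancel[OF summable_LIMSEQ_zero[OF summable_a]])
    then have "filterlim a (at 0) sequentially"
      using a0 by (auto simp: filterlim_at)
    then have "eventually (\<lambda>j. u (a j) / \<phi> (norm (a j)) < real M) sequentially"
      using ev by (auto simp: filterlim_iff)
    moreover have "eventually (\<lambda>j. M < j) sequentially"
      by (rule eventually_gt_at_top)
    ultimately have "eventually (\<lambda>j::nat. False) sequentially"
    proof eventually_elim
      case (elim j)
      have "norm (a j) < 1" unfolding norm_a using power_Suc_less_one[of "1 / 2 :: real" j] by simp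
      then have \<phi>: "\<phi> (norm (a j)) > 0" using assms(6) a0[of j] by auto
      have "real j * \<phi> (norm (a j)) \<le> \<sigma> j powr (- h)" by (rule \<sigma>)
      also have "\<dots> \<le> eps * \<sigma> j powr (- h)" using eps by (simp add: mult_le_cancel_right1)
      also have "\<dots> \<le> u (a j)" using lower[OF a0[of j], of j] by simp
      finally have "real j \<le> u (a j) / \<phi> (norm (a j))"
        using \<phi> by (simp add: field_simps)
      then show ?case using elim by linarith
    qed
    then show False by simp
  qed
  have "u x > 0" if "x \<noteq> 0" for x
  proof -
    have "0 \<le> eps * (\<sigma> 0 + (x - a 0) \<bullet> (x - a 0)) powr (- h)" using eps by simp
    with lower[OF that, of 0] show ?thesis by linarith
  qed
  moreover have "0 \<le> - (laplacian ^^ m) u x" if "x \<noteq> 0" for x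
    using sums_le[OF _ sums_zero lap_u[OF that]] f_nonneg by simp
  moreover have "smooth_on (- {0}) u"
    unfolding u_def by (rule smooth_on_corrected_sum[OF kV kK])
  ultimately show ?thesis
    using upper limsup by blast
qed

end
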